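(* Every (finite) polyhedron belongs to the class $0\text{-}CR$; that is, if $X$ is a polyhedron, then $CR(f)$ is $0$-dimensional for a generic map $f\in C(X,X)$.
   Context: A polyhedron is the union $|\mathcal W|=\bigcup\mathcal W$ of the simplices of a finite simplicial complex $\mathcal W$ in a Euclidean space. For a compact metric space $(X,d)$, $C(X,X)$ is the space of continuous self-maps with the topology of uniform convergence. For $f\in C(X,X)$ and $\epsilon>0$, an $\epsilon$-chain for $f$ from $x$ to $y$ is a finite sequence $x=x_0,x_1,\dots,x_n=y$ ($n\ge 1$) in $X$ with $d(f(x_{i-1}),x_i)<\epsilon$ for $i=1,\dots,n$. A point $x$ is chain recurrent for $f$ if for each $\epsilon>0$ there is an $\epsilon$-chain for $f$ from $x$ to $x$; $CR(f)$ is the set of chain recurrent points of $f$. A property holds for a generic $f\in C(X,X)$ if the set of maps having it is residual, i.e. contains a dense $G_\delta$-subset of $C(X,X)$. The class $0\text{-}CR$ consists of all compact metric spaces $X$ such that $CR(f)$ is $0$-dimensional for a generic $f\in C(X,X)$. *)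

theory Defs
  imports "HOL-Analysis.Analysis"
begin

definition eps_chain :: "'a metric \<Rightarrow> ('a \<Rightarrow> 'a) \<Rightarrow> real \<Rightarrow> 'a \<Rightarrow> 'a \<Rightarrow> bool" where
  "eps_chain m f e x y \<longleftrightarrow>
     (\<exists>n::nat. \<exists>c::nat \<Rightarrow> 'a. 1 \<le> n \<and> c 0 = x \<and> c n = y \<and>
        (\<forall>i\<le>n. c i \<in> mspace m) \<and>
        (\<forall>i\<in>{1..n}. mdist m (f (c (i - 1))) (c i) < e))"

definition chain_recurrent_set :: "'a metric \<Rightarrow> ('a \<Rightarrow> 'a) \<Rightarrow> 'a set" where
  "chain_recurrent_set m f = {x \<in> mspace m. \<forall>e>0. eps_chain m f e x x}"

definition residual_in :: "'a topology \<Rightarrow> 'a set \<Rightarrow> bool" where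
  "residual_in T S \<longleftrightarrow>
     S \<subseteq> topspace T \<and> (\<exists>G. G \<subseteq> S \<and> gdelta_in T G \<and> T closure_of G = topspace T)"

(* Small inductive dimension exactly 0; dimension at most -1 characterizes the empty space. *)
definition zero_dimensional :: "'a topology \<Rightarrow> bool" where
  "zero_dimensional T \<longleftrightarrow> T dim_le 0 \<and> \<not> T dim_le (- 1)"

(* The library function space consists of bounded continuous maps, extensional outside the
   domain, under the sup metric; boundedness is automatic for compact spaces. *)
definition self_maps :: "'a metric \<Rightarrow> ('a \<Rightarrow> 'a) metric" where
  "self_maps m = cfunspace (mtopology_of m) m"

definition zero_CR :: "'a metric set" where
  "zero_CR = {m. compact_space (mtopology_of m) \<and>
     residual_in (mtopology_of (self_maps m))
       {f \<in> mspace (self_maps m).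
          zero_dimensional (subtopology (mtopology_of m) (chain_recurrent_set m f))}}"

end

theory Submission
  imports Defs
begin

text \<open>
  By Baire's theorem it is enough to produce, for each scale \<open>e\<close>, a dense open set of maps \<open>f\<close>
  such that for some \<open>d > 0\<close> the points lying on a closed \<open>d\<close>-chain of \<open>f\<close> are covered by pairwise
  disjoint open sets of diameter less than \<open>e\<close>
  (\<open>finely_separated\<close>, \<open>zero_CR_if_dense_finely_separated\<close>). A map in all of these sets has a chain
  recurrent set with small relatively clopen pieces around each point, hence of dimension at most \<open>0\<close>;
  it is nonempty because an accumulation point of any orbit is chain recurrent. Openness is immediate,
  since a \<open>d/2\<close>-chain of a map within \<open>d/2\<close> of \<open>f\<close> is a \<open>d\<close>-chain of \<open>f\<close>. The content is density,
  and this is where the polyhedral structure enters.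

  Let \<open>K\<close> be a fine triangulation of the polyhedron \<open>X\<close>, with barycentric coordinates \<open>t\<^sub>v\<close> for its
  vertices \<open>v\<close>. Two maps are composed.

  \<^item> \<open>h\<close> is a simplicial approximation of \<open>f\<close>, linear on the simplices of a finer subdivision \<open>L\<close> of
    \<open>K\<close> and sending vertices of \<open>L\<close> to vertices of \<open>K\<close>. As \<open>L\<close> subdivides \<open>K\<close>, a point of an
    \<open>i\<close>-simplex of \<open>K\<close> lies in a simplex of \<open>L\<close> with at most \<open>i + 1\<close> corners, so \<open>h\<close> maps it to a
    point with at most \<open>i + 1\<close> nonzero coordinates: \<open>h\<close> respects the skeleta of \<open>K\<close>
    (\<open>cellular_approximation\<close>).

  \<^item> \<open>r\<close> replaces each coordinate \<open>t\<^sub>v\<close> by \<open>max (t\<^sub>v - \<delta>) 0\<close> and normalizes. It moves no point out of a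
    simplex containing it, and it pushes a point with \<open>j\<close> coordinates above \<open>\<delta>\<close> into a simplex with
    \<open>j\<close> corners (\<open>shrink_to_large_corners\<close>).

  The map \<open>g = h \<circ> r\<close> is close to \<open>f\<close>. Write \<open>N x\<close> for the number of coordinates of \<open>x\<close> that are at least
  \<open>\<delta>\<close>, and \<open>M x\<close> for the number of those above \<open>\<delta>\<close>. Then \<open>g x\<close> has at most \<open>M x\<close> nonzero coordinates,
  and each coordinate that is at least \<open>\<delta>\<close> at a point near \<open>g x\<close> is nonzero at \<open>g x\<close>. So
  \<open>N y \<le> M x \<le> N x\<close> whenever \<open>y\<close> is close enough to \<open>g x\<close>: along a chain with small errors \<open>N\<close> never
  increases, and on a closed chain \<open>N x = M x\<close>, that is, no coordinate equals \<open>\<delta>\<close>. The open set where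
  no coordinate equals \<open>\<delta>\<close> splits into disjoint open pieces according to which coordinates exceed \<open>\<delta>\<close>.
  If \<open>\<delta>\<close> is less than the reciprocal of the number of vertices, then some coordinate does, and the
  piece lies in the open star of a vertex of \<open>K\<close>, which is small
  (\<open>finely_separated_off_threshold\<close>, \<open>separating_approximation\<close>).
\<close>

section \<open>Chain recurrence at a finite scale\<close>

definition eps_recurrent :: "'a metric \<Rightarrow> ('a \<Rightarrow> 'a) \<Rightarrow> real \<Rightarrow> 'a set" where
  "eps_recurrent m f e = {x \<in> mspace m. eps_chain m f e x x}"

definition finely_separated :: "'a metric \<Rightarrow> real \<Rightarrow> 'a set \<Rightarrow> bool" where
  "finely_separated m e A \<longleftrightarrow>
     (\<exists>\<U>. disjoint \<U> \<and> A \<subseteq> \<Union>\<U> \<and>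
        (\<forall>U\<in>\<U>. openin (mtopology_of m) U \<and> (\<forall>x\<in>U. \<forall>y\<in>U. mdist m x y < e)))"

lemma finely_separated_subset:
  "finely_separated m e B \<Longrightarrow> A \<subseteq> B \<Longrightarrow> finely_separated m e A"
  unfolding finely_separated_def by (meson order_trans)

lemma finely_separated_mono:
  "finely_separated m d A \<Longrightarrow> d \<le> e \<Longrightarrow> finely_separated m e A"
  unfolding finely_separated_def by (meson order_less_le_trans)

text \<open>
  Each member of a separating family traces a relatively clopen subset on the covered set, because the
  trace of the union of the other members is its complement.
\<close>

lemma finely_separated_imp_dim_le_0:
  assumes sep: "\<And>e. e > 0 \<Longrightarrow> finely_separated m e A"
  shows "subtopology (mtopology_of m) A dim_le 0"
proof -
  interpret M: Metric_space "mspace m" "mdist m" by simp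
  let ?X = "subtopology (mtopology_of m) A"
  have "\<exists>U. a \<in> U \<and> U \<subseteq> V \<and> closedin ?X U \<and> openin ?X U" if "openin ?X V" "a \<in> V" for V a
  proof -
    obtain V' where V': "openin (mtopology_of m) V'" "V = V' \<inter> A"
      using \<open>openin ?X V\<close> by (auto simp: openin_subtopology)
    then obtain e where e: "e > 0" "M.mball a e \<subseteq> V'"
      using \<open>a \<in> V\<close> by (auto simp: mtopology_of_def M.openin_mtopology)
    obtain \<U> where \<U>: "disjoint \<U>" "A \<subseteq> \<Union>\<U>"
      and op: "\<And>U. U \<in> \<U> \<Longrightarrow> openin (mtopology_of m) U"
      and small: "\<And>U x y. U \<in> \<U> \<Longrightarrow> x \<in> U \<Longrightarrow> y \<in> U \<Longrightarrow> mdist m x y < e"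
      using sep[OF e(1)] unfolding finely_separated_def by metis
    have "a \<in> A" using that(2) V' by auto
    then obtain U where U: "U \<in> \<U>" "a \<in> U" using \<U> by auto
    have openA: "openin ?X (W \<inter> A)" if "openin (mtopology_of m) W" for W
      using that by (auto simp: openin_subtopology)
    have "openin (mtopology_of m) (\<Union>(\<U> - {U}))"
      using op by (intro openin_Union) auto
    moreover have "topspace ?X - U \<inter> A = \<Union>(\<U> - {U}) \<inter> A"
    proof -
      have "topspace ?X = A \<inter> mspace m" by auto
      moreover have "U' \<subseteq> mspace m" if "U' \<in> \<U>" for U'
        using openin_subset[OF op[OF that]] by simp
      moreover have "U' \<inter> U = {}" if "U' \<in> \<U>" "U' \<noteq> U" for U'
        using \<U>(1) U that by (auto simp: pairwise_def disjnt_def)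
      ultimately show ?thesis using \<U>(2) U by blast
    qed
    ultimately have "closedin ?X (U \<inter> A)"
      using openA op[OF U(1)] by (metis closedin_def openin_subset)
    moreover have "openin ?X (U \<inter> A)" using openA op[OF U(1)] .
    moreover have "U \<inter> A \<subseteq> V"
      using e(2) small[OF U(1,2)] openin_subset[OF op[OF U(1)]] V' U(2)
      by (force simp: M.in_mball)
    ultimately show ?thesis using U \<open>a \<in> A\<close> by blast
  qed
  then show ?thesis
    unfolding dimension_le_0_neighbourhood_base_of_clopen
    by (subst open_neighbourhood_base_of) (simp, meson)
qed

text \<open>
  Finite-scale chain recurrence is monotone under perturbation of the map; this makes fine separation
  of the recurrent points an open condition on the map.
\<close>

lemma eps_chain_perturb:
  assumes ch: "eps_chain m h d x y"
    and m: "f \<in> mspace m \<rightarrow> mspace m" "h \<in> mspace m \<rightarrow> mspace m"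
    and near: "\<And>x. x \<in> mspace m \<Longrightarrow> mdist m (f x) (h x) \<le> d'"
  shows "eps_chain m f (d + d') x y"
proof -
  obtain n :: nat and c where c: "1 \<le> n" "c 0 = x" "c n = y" "\<forall>i\<le>n. c i \<in> mspace m"
     "\<forall>i\<in>{1..n}. mdist m (h (c (i - 1))) (c i) < d"
    using ch unfolding eps_chain_def by blast
  have "mdist m (f (c (i - 1))) (c i) < d + d'" if "i \<in> {1..n}" for i
  proof -
    have i: "c (i - 1) \<in> mspace m" "c i \<in> mspace m" using that c(4) by auto
    then have "f (c (i-1)) \<in> mspace m" "h (c (i-1)) \<in> mspace m" using m by auto
    then show ?thesis
      using mdist_triangle[of "f (c (i-1))" m "h (c (i-1))" "c i"] near[OF i(1)] bspec[OF c(5) that] i(2)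
      by linarith
  qed
  with c show ?thesis unfolding eps_chain_def by blast
qed

lemma chain_recurrent_set_iff_eps_recurrent:
  "x \<in> chain_recurrent_set m f \<longleftrightarrow> x \<in> mspace m \<and> (\<forall>e>0. x \<in> eps_recurrent m f e)"
  by (auto simp: chain_recurrent_set_def eps_recurrent_def)

text \<open>
  An accumulation point of an orbit is visited by the orbit, up to any given error, infinitely often;
  two such visits cut out of the orbit a closed chain through the point.
\<close>

lemma chain_recurrent_set_nonempty:
  assumes cpt: "compact_space (mtopology_of m)" and ne: "mspace m \<noteq> {}"
    and cont: "continuous_map (mtopology_of m) (mtopology_of m) f"
  shows "chain_recurrent_set m f \<noteq> {}"
proof -
  interpret M: Metric_space "mspace m" "mdist m" by simp
  have fm: "f x \<in> mspace m" if "x \<in> mspace m" for x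
    using cont that by (auto simp: continuous_map_def)
  obtain a where a: "a \<in> mspace m" using ne by auto
  define s where "s n = (f ^^ n) a" for n
  have s: "s n \<in> mspace m" and s_Suc: "s (Suc n) = f (s n)" for n
    unfolding s_def by (induction n) (auto simp: a fm)
  obtain l r where l: "l \<in> mspace m" "strict_mono r" "limitin M.mtopology (s \<circ> r) l sequentially"
    using cpt s unfolding mtopology_of_def M.compact_space_sequentially by (meson image_subsetI)
  have "eps_chain m f e l l" if "e > 0" for e
  proof -
    obtain d where d: "d > 0" "\<And>x. x \<in> mspace m \<Longrightarrow> mdist m l x < d \<Longrightarrow> mdist m (f l) (f x) < e"
      using M.metric_continuous_map[OF M.Metric_space_axioms, of f] cont \<open>e > 0\<close> l(1)
      unfolding mtopology_of_def by meson
    have "\<exists>N. \<forall>n\<ge>N. mdist m (s (r n)) l < min d e"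
      using l(3) d(1) \<open>e > 0\<close> unfolding M.limit_metric_sequentially comp_def
      by (metis min_less_iff_conj)
    then obtain N where N: "\<And>n. n \<ge> N \<Longrightarrow> mdist m (s (r n)) l < min d e" by blast
    \<comment> \<open>The visits with numbers N and N + 2 are at least two steps apart, so that the chain leaving the limit point meets the orbit before it returns.\<close>
    define p where "p = r N"
    define q where "q = r (N + 2) - p"
    have "r N < r (N + 1)" "r (N + 1) < r (N + 2)" using l(2) by (auto simp: strict_mono_def)
    then have q: "q \<ge> 2" "p + q = r (N + 2)" by (auto simp: q_def p_def)
    define c where "c i = (if i = 0 \<or> i = q then l else s (p + i))" for i
    have "mdist m (f (c (i - 1))) (c i) < e" if i: "i \<in> {1..q}" for i
    proof -
      consider "i = 1" | "i \<noteq> 1" "i < q" | "i \<noteq> 1" "i = q" using i by force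
      then show ?thesis
      proof cases
        case 1
        then have "c i = f (s p)" "c (i - 1) = l" using q by (auto simp: c_def s_Suc)
        then show ?thesis using d(2)[OF s] N[of N] by (simp add: p_def mdist_commute)
      next
        case 2
        have "c (i-1) = s (p + (i - 1))" "c i = s (p + i)" using i 2 by (auto simp: c_def)
        moreover have "f (s (p + (i - 1))) = s (p + i)" 
          using i by (simp flip: s_Suc) 
        ultimately show ?thesis using s \<open>e > 0\<close> by simp
      next
        case 3
        have "c (i-1) = s (p + (i - 1))" using i q 3 by (auto simp: c_def)
        moreover have "f (s (p + (i - 1))) = s (p + i)" 
          using i by (simp flip: s_Suc) 
        ultimately show ?thesis using N[of "N+2"] q 3 by (simp add: c_def)
      qed
    qed
    moreover have "c i \<in> mspace m" for i using l s by (auto simp: c_def)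
    ultimately show ?thesis unfolding eps_chain_def using q
      by (intro exI[of _ q] exI[of _ c]) (auto simp: c_def)
  qed
  then show ?thesis using l(1) by (auto simp: chain_recurrent_set_def)
qed

text \<open>
  \<open>N\<close> does not increase along a chain, and its first step already loses the difference between
  \<open>N\<close> and \<open>M\<close>. For a closed chain this forces \<open>N\<close> and \<open>M\<close> to agree.
\<close>

lemma eps_chain_potential_descent:
  fixes N M :: "'a \<Rightarrow> nat"
  assumes "eps_chain m g e x y"
    and step: "\<And>x y. x \<in> mspace m \<Longrightarrow> y \<in> mspace m \<Longrightarrow> mdist m (g x) y < e \<Longrightarrow> N y \<le> M x"
    and MN: "\<And>x. x \<in> mspace m \<Longrightarrow> M x \<le> N x"
  shows "N y \<le> M x"
proof -
  obtain n :: nat and c where c: "1 \<le> n" "c 0 = x" "c n = y" "\<forall>i\<le>n. c i \<in> mspace m"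
     "\<forall>i\<in>{1..n}. mdist m (g (c (i - 1))) (c i) < e"
    using assms(1) unfolding eps_chain_def by blast
  have "N (c (Suc i)) \<le> M x" if "Suc i \<le> n" for i
    using that
  proof (induction i)
    case 0
    then show ?case using step[of "c 0" "c 1"] c by force
  next
    case (Suc i)
    have "N (c (Suc (Suc i))) \<le> M (c (Suc i))"
      using step[of "c (Suc i)" "c (Suc (Suc i))"] c Suc.prems by force
    also have "\<dots> \<le> N (c (Suc i))" using MN c Suc.prems by simp
    also have "\<dots> \<le> M x" using Suc by simp
    finally show ?case .
  qed
  from this[of "n - 1"] show ?thesis using c by simp
qed

text \<open>
  The reduction of a residual property to a density statement: \<open>G k\<close> below is the open dense set of
  maps whose recurrent points at some scale can be separated into pieces of diameter less than
  \<open>1 / (k + 1)\<close>.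
\<close>

proposition zero_CR_if_dense_finely_separated:
  assumes cpt: "compact_space (mtopology_of m)" and ne: "mspace m \<noteq> {}"
    and dense: "\<And>f e. f \<in> mspace (self_maps m) \<Longrightarrow> e > 0 \<Longrightarrow>
       \<exists>g\<in>mspace (self_maps m). (\<forall>x\<in>mspace m. mdist m (f x) (g x) < e) \<and>
          (\<exists>d>0. finely_separated m e (eps_recurrent m g d))"
  shows "m \<in> zero_CR"
proof -
  interpret M: Metric_space "mspace m" "mdist m" by simp
  let ?S = "self_maps m"
  interpret S: Metric_space "mspace ?S" "mdist ?S" by simp
  define G where "G k = {f \<in> mspace ?S. \<exists>d>0. finely_separated m (inverse (real (Suc k))) (eps_recurrent m f d)}" for k
  have maps: "f \<in> mspace m \<rightarrow> mspace m" if "f \<in> mspace ?S" for f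
    using that by (auto simp: self_maps_def)
  have Gopen: "openin S.mtopology (G k)" for k
    unfolding S.openin_mtopology
  proof (intro conjI allI impI)
    show "G k \<subseteq> mspace ?S" by (auto simp: G_def)
    fix f assume "f \<in> G k"
    then obtain d where f: "f \<in> mspace ?S" and d: "d > 0"
      "finely_separated m (inverse (real (Suc k))) (eps_recurrent m f d)"
      by (auto simp: G_def)
    have "h \<in> G k" if h: "h \<in> S.mball f (d/2)" for h
    proof -
      have hS: "h \<in> mspace ?S" "mdist ?S f h \<le> d/2" using h by auto
      have "mdist m (f x) (h x) \<le> d/2" if "x \<in> mspace m" for x
        using mdist_cfunspace_imp_mdist_le[of f "mtopology_of m" m h "d/2" x] f hS that
        unfolding self_maps_def by auto
      then have "eps_recurrent m h (d/2) \<subseteq> eps_recurrent m f d"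
        using eps_chain_perturb[of m h "d/2" _ _ f "d/2"] maps f hS(1)
        by (auto simp: eps_recurrent_def)
      then show ?thesis
        unfolding G_def using hS(1) d finely_separated_subset half_gt_zero by blast
    qed
    then show "\<exists>r>0. S.mball f r \<subseteq> G k" using d(1) by (meson half_gt_zero subsetI)
  qed
  have Gdense: "S.mtopology closure_of (G k) = mspace ?S" for k
  proof -
    have "\<exists>g\<in>G k. g \<in> S.mball f r" if f: "f \<in> mspace ?S" and r: "r > 0" for f r
    proof -
      define e where "e = min (r/2) (inverse (real (Suc k)))"
      have "e > 0" using r by (simp add: e_def)
      then obtain g d where g: "g \<in> mspace ?S" "\<And>x. x \<in> mspace m \<Longrightarrow> mdist m (f x) (g x) < e"
        "d > 0" "finely_separated m e (eps_recurrent m g d)"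
        using dense[OF f \<open>e > 0\<close>] by blast
      have "g \<in> G k"
        using g finely_separated_mono[OF g(4), of "inverse (real (Suc k))"]
        by (auto simp: G_def e_def)
      moreover have "mdist ?S f g \<le> e"
        unfolding self_maps_def using g(2) \<open>e > 0\<close>
        by (intro mdist_cfunspace_le) (auto simp: less_imp_le)
      ultimately show ?thesis using f g(1) r by (auto simp: e_def)
    qed
    then show ?thesis unfolding S.metric_closure_of by auto
  qed
  have "mcomplete_of ?S"
    using M.mcomplete_cfunspace[of "mtopology_of m"] M.compact_space_imp_mcomplete cpt
    unfolding self_maps_def M.Self_def mtopology_of_def by simp
  then have "S.mcomplete" by (simp add: mcomplete_of_def)
  then have dns: "S.mtopology closure_of (\<Inter>(range G)) = mspace ?S"
    using Gopen Gdense by (intro S.metric_Baire_category) auto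
  have gd: "gdelta_in S.mtopology (\<Inter>(range G))"
    using Gopen by (intro gdelta_in_Inter) (auto intro: open_imp_gdelta_in)
  have zd: "zero_dimensional (subtopology (mtopology_of m) (chain_recurrent_set m f))"
    if f: "f \<in> \<Inter>(range G)" for f
  proof -
    let ?A = "chain_recurrent_set m f"
    have "finely_separated m e ?A" if "e > 0" for e
    proof -
      obtain k where k: "inverse (real (Suc k)) < e" using reals_Archimedean[OF \<open>e > 0\<close>] by auto
      obtain d where "d > 0" and d: "finely_separated m (inverse (real (Suc k))) (eps_recurrent m f d)"
        using f by (auto simp: G_def)
      have "?A \<subseteq> eps_recurrent m f d" using \<open>d > 0\<close> by (auto simp: chain_recurrent_set_iff_eps_recurrent)
      then show ?thesis using finely_separated_mono[OF finely_separated_subset[OF d]] k by simp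
    qed
    then have "subtopology (mtopology_of m) ?A dim_le 0" by (rule finely_separated_imp_dim_le_0)
    moreover have "f \<in> mspace ?S" using f by (auto simp: G_def)
    then have "?A \<noteq> {}"
      using chain_recurrent_set_nonempty[OF cpt ne, of f] by (auto simp: self_maps_def)
    then have "topspace (subtopology (mtopology_of m) ?A) \<noteq> {}"
      by (auto simp: chain_recurrent_set_def)
    then have "\<not> subtopology (mtopology_of m) ?A dim_le -1"
      by (metis dimension_le_eq_empty topspace_discrete_topology)
    ultimately show ?thesis by (simp add: zero_dimensional_def)
  qed
  have GS: "\<Inter>(range G) \<subseteq> mspace ?S" by (auto simp: G_def)
  have "residual_in (mtopology_of ?S)
       {f \<in> mspace ?S. zero_dimensional (subtopology (mtopology_of m) (chain_recurrent_set m f))}"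
    unfolding residual_in_def
  proof (intro conjI exI)
    show "\<Inter>(range G) \<subseteq> {f \<in> mspace ?S. zero_dimensional (subtopology (mtopology_of m) (chain_recurrent_set m f))}"
      using zd GS by blast
  qed (use gd dns in \<open>auto simp: mtopology_of_def\<close>)
  with cpt show ?thesis by (simp add: zero_CR_def)
qed


section \<open>Barycentric coordinates on a simplicial complex\<close>

definition convex_coords :: "'a::euclidean_space set \<Rightarrow> ('a \<Rightarrow> real) \<Rightarrow> 'a \<Rightarrow> bool" where
  "convex_coords S u x \<longleftrightarrow>
     (\<forall>w. 0 \<le> u w) \<and> (\<forall>w. w \<notin> S \<longrightarrow> u w = 0) \<and> sum u S = 1 \<and> (\<Sum>w\<in>S. u w *\<^sub>R w) = x"

definition corners :: "'a::euclidean_space set \<Rightarrow> 'a set" where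
  "corners C = {v. v extreme_point_of C}"

text \<open>
  The coordinate vector vanishes off the corners of the chosen simplex, so that all simplices containing
  a point give the same vector on the whole space and the description is definite.
\<close>

definition barycentric :: "'a::euclidean_space set set \<Rightarrow> 'a \<Rightarrow> 'a \<Rightarrow> real" where
  "barycentric K x = (THE u. \<exists>C\<in>K. convex_coords (corners C) u x)"

lemma convex_coords_mono:
  assumes "convex_coords S u x" "S \<subseteq> T" "finite T"
  shows "convex_coords T u x"
proof -
  have 0: "\<forall>w\<in>T - S. u w = 0" using assms(1) by (auto simp: convex_coords_def)
  have "sum u T = sum u S"
    using 0 by (intro sum.mono_neutral_right assms)
  moreover have "(\<Sum>w\<in>T. u w *\<^sub>R w) = (\<Sum>w\<in>S. u w *\<^sub>R w)"
    using 0 by (intro sum.mono_neutral_right assms) auto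
  ultimately show ?thesis using assms by (auto simp: convex_coords_def)
qed

lemma in_convex_hull_iff_convex_coords:
  assumes "finite S"
  shows "x \<in> convex hull S \<longleftrightarrow> (\<exists>u. convex_coords S u x)"
proof
  assume "x \<in> convex hull S"
  then obtain u where u: "\<forall>w\<in>S. 0 \<le> u w" "sum u S = 1" "(\<Sum>w\<in>S. u w *\<^sub>R w) = x"
    using assms by (auto simp: convex_hull_finite)
  then have "convex_coords S (\<lambda>w. if w \<in> S then u w else 0) x"
    by (auto simp: convex_coords_def if_distrib[of "\<lambda>c. c *\<^sub>R _"] sum.If_cases cong: sum.cong if_cong)
  then show "\<exists>u. convex_coords S u x" by blast
next
  assume "\<exists>u. convex_coords S u x"
  then show "x \<in> convex hull S"
    using assms by (auto simp: convex_hull_finite convex_coords_def)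
qed

text \<open>
  On an affinely independent set each coordinate is the restriction of an affine function of the whole
  space. This yields at once the uniqueness of coordinates and their continuity on a simplex.
\<close>

lemma affine_coordinate_function:
  fixes S :: "'a::euclidean_space set"
  assumes "\<not> affine_dependent S"
  obtains h where "continuous_on UNIV h" "\<And>u x. convex_coords S u x \<Longrightarrow> h x = u v"
proof (cases "v \<in> S")
  case False
  then show ?thesis using that[of "\<lambda>_. 0"] by (auto simp: convex_coords_def)
next
  case True
  have fin: "finite S" using assms by (rule aff_independent_finite)
  \<comment> \<open>A linear g with value 1 on every edge vector from v to another point; 1 - g (x - v) is then the coordinate at v.\<close>
  let ?B = "(\<lambda>x. x - v) ` (S - {v})"
  have "\<not> dependent ?B"
    using affine_dependent_iff_dependent[of v "S - {v}"] assms True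
    by (simp add: insert_absorb image_def Setcompr_eq_image)
  then obtain g :: "'a \<Rightarrow> real" where g: "linear g" "\<forall>b\<in>?B. g b = 1"
    using linear_independent_extend[of ?B "\<lambda>_. 1"] by auto
  show ?thesis
  proof (rule that[of "\<lambda>x. 1 - g (x - v)"])
    show "continuous_on UNIV (\<lambda>x. 1 - g (x - v))"
      by (intro continuous_intros linear_continuous_on_compose[OF _ g(1)])
    fix u x assume "convex_coords S u x"
    then have u: "sum u S = 1" "(\<Sum>w\<in>S. u w *\<^sub>R w) = x" by (auto simp: convex_coords_def)
    have "x - v = (\<Sum>w\<in>S. u w *\<^sub>R (w - v))"
      using u by (simp add: scaleR_diff_right sum_subtractf flip: scaleR_left.sum)
    then have "g (x - v) = (\<Sum>w\<in>S. u w * g (w - v))"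
      by (simp add: linear_sum[OF g(1)] linear_cmul[OF g(1)])
    also have "\<dots> = u v * g (v - v) + (\<Sum>w\<in>S-{v}. u w * g (w - v))"
      using fin True by (simp add: sum.remove)
    also have "\<dots> = (\<Sum>w\<in>S-{v}. u w)"
      using g by (auto simp: linear_0[OF g(1)] intro!: sum.cong)
    also have "\<dots> = 1 - u v" using u(1) fin True by (simp add: sum.remove)
    finally show "1 - g (x - v) = u v" by simp
  qed
qed

lemma convex_coords_unique:
  assumes "\<not> affine_dependent S" "convex_coords S u x" "convex_coords S u' x"
  shows "u = u'"
proof
  fix v
  obtain h where "\<And>u x. convex_coords S u x \<Longrightarrow> h x = u v"
    using affine_coordinate_function[OF assms(1)] by metis
  then show "u v = u' v" using assms by metis
qed

lemma simplex_corners: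
  assumes "n simplex C"
  shows "\<not> affine_dependent (corners C)" "finite (corners C)" "convex hull (corners C) = C"
    "corners C \<subseteq> C" "int (card (corners C)) = aff_dim C + 1"
proof -
  obtain S where S: "finite S" "\<not> affine_dependent S" "int (card S) = n + 1" "C = convex hull S"
    using assms by (auto simp: simplex)
  then have "corners C = S"
    by (auto simp: corners_def extreme_point_of_convex_hull_affine_independent)
  with S aff_dim_simplex[OF assms] show "\<not> affine_dependent (corners C)" "finite (corners C)" "convex hull (corners C) = C"
    "corners C \<subseteq> C" "int (card (corners C)) = aff_dim C + 1"
    by (auto simp: hull_inc)
qed

locale geometric_complex =
  fixes K :: "'a::euclidean_space set set"
  assumes complex: "simplicial_complex K"
begin

lemma finite_K: "finite K"
  using complex by (simp add: simplicial_complex_def)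

lemma simplexK: "C \<in> K \<Longrightarrow> \<exists>n. n simplex C"
  using complex by (simp add: simplicial_complex_def)

lemma corners_K:
  assumes "C \<in> K"
  shows "\<not> affine_dependent (corners C)" "finite (corners C)" "convex hull (corners C) = C"
    "corners C \<subseteq> C" "int (card (corners C)) = aff_dim C + 1"
  using simplexK[OF assms] simplex_corners by metis+

lemma coords_exist:
  assumes "C \<in> K" "x \<in> C"
  shows "\<exists>u. convex_coords (corners C) u x"
  using in_convex_hull_iff_convex_coords[OF corners_K(2)] corners_K(3) assms by metis

text \<open>
  Two simplices meet in a common face whose corners are corners of both. Hence coordinates with respect
  to that face, padded by zeros, are coordinates with respect to either simplex.
\<close>

lemma coords_agree:
  assumes "C \<in> K" "D \<in> K" "convex_coords (corners C) u x" "convex_coords (corners D) u' x"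
  shows "u = u'"
proof -
  have x: "x \<in> C \<inter> D"
    using assms in_convex_hull_iff_convex_coords[OF corners_K(2)] corners_K(3) by blast
  have face: "C \<inter> D face_of C" "C \<inter> D face_of D"
    using complex assms(1,2) unfolding simplicial_complex_def by (metis inf_commute)+
  then have F: "C \<inter> D \<in> K" using complex assms(1) unfolding simplicial_complex_def by blast
  obtain w where w: "convex_coords (corners (C \<inter> D)) w x" using coords_exist[OF F x] ..
  have "corners (C \<inter> D) \<subseteq> corners C" "corners (C \<inter> D) \<subseteq> corners D"
    using extreme_point_of_face[OF face(1)] extreme_point_of_face[OF face(2)]
    unfolding corners_def by blast+
  then have "convex_coords (corners C) w x" "convex_coords (corners D) w x"
    using convex_coords_mono[OF w] corners_K assms(1,2) by auto
  then show ?thesis using assms corners_K(1) convex_coords_unique by metis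
qed

lemma barycentric_eqI:
  assumes "C \<in> K" "S \<subseteq> corners C" "convex_coords S u x"
  shows "barycentric K x = u"
proof -
  have "convex_coords (corners C) u x"
    using convex_coords_mono assms corners_K by blast
  then show ?thesis
    unfolding barycentric_def using assms(1) coords_agree by blast
qed

lemma barycentric_coords:
  assumes "C \<in> K" "x \<in> C"
  shows "convex_coords (corners C) (barycentric K x) x"
  using coords_exist[OF assms] barycentric_eqI[OF assms(1)] by blast

lemma continuous_barycentric: "continuous_on (\<Union>K) (\<lambda>x. barycentric K x v)"
proof -
  have "continuous_on C (\<lambda>x. barycentric K x v)" if "C \<in> K" for C
  proof -
    obtain h where h: "continuous_on UNIV h" "\<And>u x. convex_coords (corners C) u x \<Longrightarrow> h x = u v"
      using affine_coordinate_function corners_K(1)[OF \<open>C \<in> K\<close>] by metis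
    have "continuous_on C h" using h(1) continuous_on_subset by blast
    then show ?thesis
      by (rule continuous_on_eq) (use h(2) barycentric_coords that in auto)
  qed
  then show ?thesis
    using continuous_on_closed_Union[of K "\<lambda>C. C"] finite_K simplexK closed_simplex by force
qed

definition verts :: "'a set" where "verts = (\<Union>C\<in>K. corners C)"

lemma finite_verts: "finite verts"
  unfolding verts_def using finite_K corners_K by blast

lemma corners_subset_verts: "C \<in> K \<Longrightarrow> corners C \<subseteq> verts"
  unfolding verts_def by blast

lemma barycentric_pos_in_corners: "C \<in> K \<Longrightarrow> x \<in> C \<Longrightarrow> barycentric K x v \<noteq> 0 \<Longrightarrow> v \<in> corners C"
  using barycentric_coords by (auto simp: convex_coords_def)

lemma barycentric_verts: "x \<in> \<Union>K \<Longrightarrow> convex_coords verts (barycentric K x) x"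
  using barycentric_coords convex_coords_mono corners_subset_verts finite_verts by blast

lemma barycentric_large:
  assumes "x \<in> \<Union>K"
  shows "\<exists>v\<in>verts. barycentric K x v \<ge> 1 / card verts"
proof (rule ccontr)
  assume "\<not> ?thesis"
  then have *: "\<And>v. v \<in> verts \<Longrightarrow> barycentric K x v < 1 / card verts" by force
  have s: "sum (barycentric K x) verts = 1"
    using barycentric_verts[OF assms] by (simp add: convex_coords_def)
  then have ne: "verts \<noteq> {}" by auto
  have "sum (barycentric K x) verts < (\<Sum>v\<in>verts. 1 / card verts)"
    using * ne finite_verts by (intro sum_strict_mono) auto
  also have "\<dots> = 1" using ne finite_verts by simp
  finally show False using s by simp
qed

lemma compact_polyhedron: "compact (\<Union>K)"
  using finite_K simplexK compact_simplex by blast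

lemma uniformly_continuous_barycentric:
  assumes "e > 0"
  shows "\<exists>d>0. \<forall>x\<in>\<Union>K. \<forall>y\<in>\<Union>K. \<forall>v\<in>verts. dist x y < d \<longrightarrow> \<bar>barycentric K x v - barycentric K y v\<bar> < e"
proof -
  have "\<exists>d>0. \<forall>x\<in>\<Union>K. \<forall>y\<in>\<Union>K. dist x y < d \<longrightarrow> \<bar>barycentric K x v - barycentric K y v\<bar> < e" for v
    using compact_uniformly_continuous[OF continuous_barycentric compact_polyhedron] assms
    unfolding uniformly_continuous_on_def dist_real_def by (metis abs_minus_commute dist_commute)
  then obtain d where d: "\<And>v. d v > 0"
     "\<And>v x y. x\<in>\<Union>K \<Longrightarrow> y\<in>\<Union>K \<Longrightarrow> dist x y < d v \<Longrightarrow> \<bar>barycentric K x v - barycentric K y v\<bar> < e"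
    by metis
  show ?thesis
  proof (intro exI[of _ "Min (insert 1 (d ` verts))"] conjI ballI impI)
    show "Min (insert 1 (d ` verts)) > 0" using d(1) finite_verts by simp
  qed (use d(2) finite_verts in simp)
qed


section \<open>Collapsing neighbourhoods of the skeleta\<close>

text \<open>
  Subtracting \<open>\<delta>\<close> from the coordinates, cutting off at zero and normalizing collapses a neighbourhood of
  each skeleton into that skeleton, simultaneously for all dimensions and without leaving any simplex.
  The bound on \<open>\<delta>\<close> guarantees that not all coordinates are cut off.
\<close>

lemma shrink_to_large_corners:
  assumes "0 < \<delta>" "\<delta> < 1 / card verts"
  obtains r where "continuous_on (\<Union>K) r" "\<And>C x. C \<in> K \<Longrightarrow> x \<in> C \<Longrightarrow> r x \<in> C"
    "\<And>x. x \<in> \<Union>K \<Longrightarrow> \<exists>F\<in>K. r x \<in> F \<and> aff_dim F + 1 \<le> int (card {v \<in> verts. \<delta> < barycentric K x v})"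
proof -
  define s where "s x = (\<Sum>v\<in>verts. max (barycentric K x v - \<delta>) 0)" for x
  define t where "t x v = (if v \<in> verts then max (barycentric K x v - \<delta>) 0 / s x else 0)" for x v
  define r where "r x = (\<Sum>v\<in>verts. t x v *\<^sub>R v)" for x
  have s: "s x > 0" if x: "x \<in> \<Union>K" for x
  proof -
    obtain v where "v \<in> verts" "barycentric K x v \<ge> 1 / card verts"
      using barycentric_large[OF x] by blast
    then show ?thesis
      unfolding s_def using finite_verts assms by (intro sum_pos2[of _ v]) auto
  qed
  have coords: "convex_coords {v \<in> verts. \<delta> < barycentric K x v} (t x) (r x)" (is "convex_coords ?S _ _")
    if x: "x \<in> \<Union>K" for x
  proof -
    have "sum (t x) verts = 1"
      using s[OF x] by (simp add: t_def flip: sum_divide_distrib) (simp add: s_def)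
    moreover have "sum (t x) verts = sum (t x) ?S"
      using finite_verts by (intro sum.mono_neutral_right) (auto simp: t_def)
    moreover have "r x = (\<Sum>v\<in>?S. t x v *\<^sub>R v)"
      unfolding r_def using finite_verts by (intro sum.mono_neutral_right) (auto simp: t_def)
    ultimately show ?thesis
      using s[OF x] unfolding convex_coords_def by (auto simp: t_def less_imp_le)
  qed
  have face: "\<exists>F\<in>K. F \<subseteq> C \<and> r x \<in> F \<and> aff_dim F + 1 \<le> int (card {v \<in> verts. \<delta> < barycentric K x v})"
    if C: "C \<in> K" "x \<in> C" for C x
  proof -
    let ?S = "{v \<in> verts. \<delta> < barycentric K x v}"
    have S: "?S \<subseteq> corners C" using barycentric_pos_in_corners[OF C] assms by force
    have F: "convex hull ?S face_of C"
      using face_of_convex_hull_affine_independent[OF corners_K(1)[OF C(1)], of "convex hull ?S"]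
        corners_K(3)[OF C(1)] S by metis
    then have "convex hull ?S \<in> K"
      using complex C(1) unfolding simplicial_complex_def by blast
    moreover have "r x \<in> convex hull ?S"
    proof -
      have "convex_coords ?S (t x) (r x)" using coords C by blast
      moreover have "finite ?S" using finite_verts by simp
      ultimately show ?thesis using in_convex_hull_iff_convex_coords by blast
    qed
    moreover have "aff_dim (convex hull ?S) + 1 \<le> int (card ?S)"
      using aff_dim_le_card[of ?S] finite_verts by (simp add: aff_dim_convex_hull)
    ultimately show ?thesis using face_of_imp_subset[OF F] by blast
  qed
  show ?thesis
  proof
    show "continuous_on (\<Union>K) r"
      unfolding r_def
    proof (intro continuous_on_sum continuous_on_scaleR continuous_on_const)
      fix v assume v: "v \<in> verts"
      have "continuous_on (\<Union>K) s"
        unfolding s_def by (intro continuous_intros continuous_barycentric)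
      moreover have "\<forall>x\<in>\<Union>K. s x \<noteq> 0" using s by (metis less_irrefl)
      ultimately have "continuous_on (\<Union>K) (\<lambda>x. max (barycentric K x v - \<delta>) 0 / s x)"
        by (intro continuous_intros continuous_barycentric)
      then show "continuous_on (\<Union>K) (\<lambda>x. t x v)" using v by (simp add: t_def)
    qed
  qed (use face in blast)+
qed

section \<open>Cellular approximation\<close>

text \<open>
  The star condition on \<open>\<phi>\<close> says that the open star of a vertex \<open>w\<close> of \<open>L\<close> is mapped by \<open>f\<close> into the open
  star of \<open>\<phi> w\<close>. So the images of the corners of a simplex around \<open>x\<close> are corners of any simplex
  containing \<open>f x\<close>, and extending \<open>\<phi>\<close> linearly makes sense and stays near \<open>f\<close>. The last conclusion
  expresses that \<open>h\<close> preserves the skeleta of \<open>K\<close>, because \<open>L\<close> subdivides every simplex of \<open>K\<close>.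
\<close>

lemma simplicial_approximation:
  assumes "geometric_complex L" and union: "\<Union>L = \<Union>K"
    and subdiv: "\<And>C. C \<in> K \<Longrightarrow> \<exists>F\<subseteq>L. C = \<Union>F"
    and star: "\<And>x w. x \<in> \<Union>K \<Longrightarrow> barycentric L x w \<noteq> 0 \<Longrightarrow> barycentric K (f x) (\<phi> w) \<noteq> 0"
    and f: "\<And>x. x \<in> \<Union>K \<Longrightarrow> f x \<in> \<Union>K"
  obtains h where "continuous_on (\<Union>K) h"
    "\<And>C x. C \<in> K \<Longrightarrow> x \<in> \<Union>K \<Longrightarrow> f x \<in> C \<Longrightarrow> h x \<in> C"
    "\<And>F x. F \<in> K \<Longrightarrow> x \<in> F \<Longrightarrow> int (card {v \<in> verts. barycentric K (h x) v \<noteq> 0}) \<le> aff_dim F + 1"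
proof -
  interpret L: geometric_complex L by fact
  define h where "h x = (\<Sum>w\<in>L.verts. barycentric L x w *\<^sub>R \<phi> w)" for x
  define T where "T x = \<phi> ` {w. barycentric L x w \<noteq> 0}" for x
  have fin: "finite {w. barycentric L x w \<noteq> 0}" and sub: "{w. barycentric L x w \<noteq> 0} \<subseteq> L.verts"
    if x: "x \<in> \<Union>K" for x
  proof -
    show "{w. barycentric L x w \<noteq> 0} \<subseteq> L.verts"
      using L.barycentric_verts x union by (auto simp: convex_coords_def)
    then show "finite {w. barycentric L x w \<noteq> 0}" using L.finite_verts finite_subset by blast
  qed
  have hull: "h x \<in> convex hull T x" if x: "x \<in> \<Union>K" for x
  proof -
    have c: "convex_coords L.verts (barycentric L x) x" using L.barycentric_verts x union by auto
    let ?P = "{w. barycentric L x w \<noteq> 0}"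
    have "sum (barycentric L x) ?P = sum (barycentric L x) L.verts"
      using L.finite_verts sub[OF x] by (intro sum.mono_neutral_left) auto
    moreover have "h x = (\<Sum>w\<in>?P. barycentric L x w *\<^sub>R \<phi> w)"
      unfolding h_def using L.finite_verts sub[OF x] by (intro sum.mono_neutral_right) auto
    moreover have "(\<Sum>w\<in>?P. barycentric L x w *\<^sub>R \<phi> w) \<in> convex hull T x"
      using c calculation(1) fin[OF x]
      by (intro convex_sum convex_convex_hull) (auto simp: convex_coords_def T_def intro!: hull_inc)
    ultimately show ?thesis by simp
  qed
  have T: "T x \<subseteq> corners C" if "C \<in> K" "x \<in> \<Union>K" "f x \<in> C" for C x
    using star that barycentric_pos_in_corners unfolding T_def by blast
  have mem: "h x \<in> C" if "C \<in> K" "x \<in> \<Union>K" "f x \<in> C" for C x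
    using hull[OF that(2)] hull_mono[OF T[OF that]] corners_K(3)[OF that(1)] by blast
  have card: "int (card {v \<in> verts. barycentric K (h x) v \<noteq> 0}) \<le> aff_dim F + 1" if F: "F \<in> K" "x \<in> F" for F x
  proof -
    have x: "x \<in> \<Union>K" using F by blast
    obtain C where C: "C \<in> K" "f x \<in> C" using f[OF x] by blast
    obtain D where D: "D \<in> L" "x \<in> D" "D \<subseteq> F" using subdiv[OF F(1)] F(2) by blast
    obtain u where u: "convex_coords (T x) u (h x)"
      using hull[OF x] in_convex_hull_iff_convex_coords[of "T x"] fin[OF x] by (auto simp: T_def)
    then have "barycentric K (h x) = u"
      using barycentric_eqI[OF C(1) T[OF C(1) x C(2)]] by blast
    then have "{v \<in> verts. barycentric K (h x) v \<noteq> 0} \<subseteq> T x" using u by (auto simp: convex_coords_def)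
    also have "T x \<subseteq> \<phi> ` corners D"
      using L.barycentric_pos_in_corners[OF D(1,2)] by (auto simp: T_def)
    finally have "card {v \<in> verts. barycentric K (h x) v \<noteq> 0} \<le> card (corners D)"
      using L.corners_K(2)[OF D(1)] by (meson card_image_le card_mono finite_imageI order_trans)
    also have "int (card (corners D)) \<le> aff_dim F + 1"
      using L.corners_K(5)[OF D(1)] aff_dim_subset[OF D(3)] by simp
    finally show ?thesis by simp
  qed
  show ?thesis
  proof
    show "continuous_on (\<Union>K) h"
      unfolding h_def using L.continuous_barycentric union
      by (intro continuous_intros) auto
  qed (use mem card in auto)
qed


lemma dist_in_fine_simplex:
  assumes "\<And>C. C \<in> K \<Longrightarrow> diameter C < \<mu>" "C \<in> K" "x \<in> C" "y \<in> C"
  shows "dist x y < \<mu>"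
proof -
  have "bounded C" using simplexK[OF assms(2)] compact_simplex compact_imp_bounded by blast
  then show ?thesis using diameter_bounded_bound[of C x y] assms by fastforce
qed

lemma fine_subdivision:
  assumes "0 < \<mu>"
  obtains L where "geometric_complex L" "\<Union>L = \<Union>K" "\<And>C. C \<in> L \<Longrightarrow> diameter C < \<mu>"
    "\<And>C. C \<in> K \<Longrightarrow> \<exists>F\<subseteq>L. C = \<Union>F"
proof -
  obtain L where L: "simplicial_complex L" "\<And>C. C \<in> L \<Longrightarrow> diameter C < \<mu>" "\<Union>L = \<Union>K"
    "\<And>C. C \<in> K \<Longrightarrow> \<exists>F. finite F \<and> F \<subseteq> L \<and> C = \<Union>F"
  proof (rule fine_simplicial_subdivision_of_cell_complex[OF assms finite_K])
    show "polytope C" if "C \<in> K" for C using that simplexK simplex_imp_polytope by blast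
    show "C1 \<inter> C2 face_of C1" if "C1 \<in> K" "C2 \<in> K" for C1 C2
      using that complex unfolding simplicial_complex_def by blast
  qed (rule that)
  show ?thesis
  proof (rule that[of L])
    show "\<exists>F\<subseteq>L. C = \<Union>F" if "C \<in> K" for C using L(4)[OF that] by blast
  qed (use L in \<open>auto simp: geometric_complex_def\<close>)
qed

text \<open>
  The vertex map required for a simplicial approximation sends \<open>w\<close> to a vertex at which the coordinate of
  \<open>f w\<close> is at least the reciprocal of the number of vertices. If \<open>L\<close> is so fine that coordinates of
  \<open>f\<close> vary by less than this amount on each simplex of \<open>L\<close>, then the coordinate remains positive on the
  whole star of \<open>w\<close>.
\<close>

lemma cellular_approximation:
  assumes f: "continuous_on (\<Union>K) f" "\<And>x. x \<in> \<Union>K \<Longrightarrow> f x \<in> \<Union>K"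
  obtains h where "continuous_on (\<Union>K) h"
    "\<And>x. x \<in> \<Union>K \<Longrightarrow> \<exists>C\<in>K. f x \<in> C \<and> h x \<in> C"
    "\<And>F x. F \<in> K \<Longrightarrow> x \<in> F \<Longrightarrow> int (card {v \<in> verts. barycentric K (h x) v \<noteq> 0}) \<le> aff_dim F + 1"
proof (cases "verts = {}")
  case True
  then have "\<Union>K = {}" using barycentric_large by blast
  then show ?thesis using that[of f] f by auto
next
  case False
  let ?n = "card verts"
  have n: "0 < 1 / real ?n" using False finite_verts by (simp add: card_gt_0_iff)
  obtain d where d: "d > 0" "\<forall>x\<in>\<Union>K. \<forall>y\<in>\<Union>K. \<forall>v\<in>verts.
      dist x y < d \<longrightarrow> \<bar>barycentric K x v - barycentric K y v\<bar> < 1 / ?n"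
    using uniformly_continuous_barycentric[OF n] by blast
  obtain \<mu> where \<mu>: "\<mu> > 0" "\<And>x y. x \<in> \<Union>K \<Longrightarrow> y \<in> \<Union>K \<Longrightarrow> dist x y < \<mu> \<Longrightarrow> dist (f x) (f y) < d"
    using compact_uniformly_continuous[OF f(1) compact_polyhedron] d(1)
    unfolding uniformly_continuous_on_def by meson
  obtain L where L: "geometric_complex L" "\<Union>L = \<Union>K" "\<And>C. C \<in> L \<Longrightarrow> diameter C < \<mu>"
    "\<And>C. C \<in> K \<Longrightarrow> \<exists>F\<subseteq>L. C = \<Union>F"
    by (rule fine_subdivision[OF \<mu>(1)]) (rule that)
  interpret L: geometric_complex L by fact
  have "\<exists>v\<in>verts. w \<in> \<Union>K \<longrightarrow> barycentric K (f w) v \<ge> 1 / ?n" for w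
    using barycentric_large f(2) False by blast
  then obtain \<phi> where \<phi>: "\<And>w. \<phi> w \<in> verts" "\<And>w. w \<in> \<Union>K \<Longrightarrow> barycentric K (f w) (\<phi> w) \<ge> 1 / ?n"
    by metis
  have star: "barycentric K (f x) (\<phi> w) \<noteq> 0" if x: "x \<in> \<Union>K" "barycentric L x w \<noteq> 0" for x w
  proof -
    obtain D where D: "D \<in> L" "x \<in> D" using x L(2) by blast
    then have w: "w \<in> D" using L.barycentric_pos_in_corners x(2) L.corners_K(4) by blast
    then have wK: "w \<in> \<Union>K" using D L(2) by blast
    have "dist x w < \<mu>" using L.dist_in_fine_simplex[OF L(3)] D w by blast
    then have "dist (f x) (f w) < d" using \<mu>(2) x wK by blast
    then have "\<bar>barycentric K (f x) (\<phi> w) - barycentric K (f w) (\<phi> w)\<bar> < 1 / ?n"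
      using d(2) f(2) x(1) wK \<phi>(1) by blast
    then show ?thesis using \<phi>(2)[OF wK] by linarith
  qed
  obtain h where h: "continuous_on (\<Union>K) h"
    "\<And>C x. C \<in> K \<Longrightarrow> x \<in> \<Union>K \<Longrightarrow> f x \<in> C \<Longrightarrow> h x \<in> C"
    "\<And>F x. F \<in> K \<Longrightarrow> x \<in> F \<Longrightarrow> int (card {v \<in> verts. barycentric K (h x) v \<noteq> 0}) \<le> aff_dim F + 1"
    by (rule simplicial_approximation[OF L(1,2,4) star f(2)]) (assumption | rule that)+
  show ?thesis
  proof (rule that[OF h(1)])
    show "\<exists>C\<in>K. f x \<in> C \<and> h x \<in> C" if "x \<in> \<Union>K" for x
      using f(2)[OF that] h(2) that by blast
  qed (use h(3) in blast)
qed

section \<open>Approximation by maps with finely separated recurrence\<close>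

text \<open>
  The pieces are indexed by the set of coordinates exceeding \<open>\<delta>\<close>. Since the coordinates sum to \<open>1\<close>, the
  bound on \<open>\<delta>\<close> makes this set nonempty, so a piece lies in the open star of a vertex and has diameter
  at most twice the mesh.
\<close>

lemma finely_separated_off_threshold:
  assumes "\<And>C. C \<in> K \<Longrightarrow> diameter C < \<mu>" "0 \<le> \<delta>" "\<delta> < 1 / card verts"
  shows "finely_separated (submetric euclidean_metric (\<Union>K)) (2 * \<mu>)
           {x \<in> \<Union>K. \<forall>v\<in>verts. barycentric K x v \<noteq> \<delta>}"
proof -
  define U where "U S = {x \<in> \<Union>K. \<forall>v\<in>verts. if v \<in> S then \<delta> < barycentric K x v else barycentric K x v < \<delta>}" for S
  have op: "openin (top_of_set (\<Union>K)) (U S)" for S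
  proof -
    have "openin (top_of_set (\<Union>K)) (\<Union>K \<inter> (\<lambda>x. barycentric K x v) -` (if v \<in> S then {\<delta><..} else {..<\<delta>}))" for v
      by (intro continuous_openin_preimage_gen continuous_barycentric) auto
    then have "openin (top_of_set (\<Union>K)) ((\<Inter>v\<in>verts. \<Union>K \<inter> (\<lambda>x. barycentric K x v) -` (if v \<in> S then {\<delta><..} else {..<\<delta>}))
       \<inter> topspace (top_of_set (\<Union>K)))"
      by (intro openin_INT finite_verts)
    moreover have "(\<Inter>v\<in>verts. \<Union>K \<inter> (\<lambda>x. barycentric K x v) -` (if v \<in> S then {\<delta><..} else {..<\<delta>}))
       \<inter> topspace (top_of_set (\<Union>K)) = U S"
      by (auto simp: U_def split: if_splits)
    ultimately show ?thesis by simp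
  qed
  have small: "dist x y < 2 * \<mu>" if "x \<in> U S" "y \<in> U S" "S \<inter> verts \<noteq> {}" "0 \<le> \<delta>" for S x y
  proof -
    obtain v where v: "v \<in> S" "v \<in> verts" using \<open>S \<inter> verts \<noteq> {}\<close> by blast
    have "dist z v < \<mu>" if "z \<in> U S" for z
    proof -
      obtain C where C: "C \<in> K" "z \<in> C" using \<open>z \<in> U S\<close> by (auto simp: U_def)
      have "barycentric K z v \<noteq> 0" using \<open>z \<in> U S\<close> v \<open>0 \<le> \<delta>\<close> by (auto simp: U_def)
      then have "v \<in> C" using barycentric_pos_in_corners[OF C] corners_K(4)[OF C(1)] by blast
      then show ?thesis using dist_in_fine_simplex assms(1) C by blast
    qed
    from this[OF that(1)] this[OF that(2)] show ?thesis using dist_triangle2[of x y v] by linarith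
  qed
  have disj: "U S \<inter> U S' = {}" if S: "S \<subseteq> verts" "S' \<subseteq> verts" "S \<noteq> S'" for S S'
  proof -
    obtain v where "v \<in> verts" "v \<in> S \<longleftrightarrow> v \<notin> S'" using S by blast
    then show ?thesis by (fastforce simp: U_def split: if_splits)
  qed
  have cover: "\<exists>S. S \<subseteq> verts \<and> S \<noteq> {} \<and> x \<in> U S"
    if x: "x \<in> \<Union>K" "\<forall>v\<in>verts. barycentric K x v \<noteq> \<delta>" for x
  proof (intro exI[of _ "{v \<in> verts. \<delta> < barycentric K x v}"] conjI)
    show "{v \<in> verts. \<delta> < barycentric K x v} \<noteq> {}"
      using barycentric_large[OF x(1)] assms(3) by force
    show "x \<in> U {v \<in> verts. \<delta> < barycentric K x v}"
      using x by (auto simp: U_def not_less order.order_iff_strict)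
  qed auto
  show ?thesis
    unfolding finely_separated_def
  proof (intro exI[of _ "U ` {S. S \<subseteq> verts \<and> S \<noteq> {}}"] conjI ballI)
    show "disjoint (U ` {S. S \<subseteq> verts \<and> S \<noteq> {}})"
      using disj by (intro pairwise_imageI) (auto simp: disjnt_def)
    show "{x \<in> \<Union>K. \<forall>v\<in>verts. barycentric K x v \<noteq> \<delta>} \<subseteq> \<Union>(U ` {S. S \<subseteq> verts \<and> S \<noteq> {}})"
      using cover by blast
  next
    fix A assume "A \<in> U ` {S. S \<subseteq> verts \<and> S \<noteq> {}}"
    then obtain S where S: "S \<subseteq> verts" "S \<noteq> {}" "A = U S" by blast
    show "openin (mtopology_of (submetric euclidean_metric (\<Union>K))) A"
      using op S(3) by (simp add: mtopology_of_submetric)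
    fix x y assume "x \<in> A" "y \<in> A"
    then show "mdist (submetric euclidean_metric (\<Union>K)) x y < 2 * \<mu>"
      using small[of x S y] S assms(2) by (simp add: Int_absorb2)
  qed
qed

text \<open>
  For the composition \<open>g\<close> of the collapse and the cellular approximation, the number of coordinates that
  are at least \<open>\<delta>\<close> cannot increase along a chain with small errors, and it drops when some coordinate equals
  \<open>\<delta>\<close> exactly. Thus no point with a coordinate equal to \<open>\<delta>\<close> lies on such a closed chain.
\<close>

lemma separating_approximation:
  assumes f: "continuous_on (\<Union>K) f" "\<And>x. x \<in> \<Union>K \<Longrightarrow> f x \<in> \<Union>K"
    and mesh: "\<And>C. C \<in> K \<Longrightarrow> diameter C < \<mu>" and ne: "\<Union>K \<noteq> {}"
    and close: "\<And>x y. x \<in> \<Union>K \<Longrightarrow> y \<in> \<Union>K \<Longrightarrow> dist x y < \<mu> \<Longrightarrow> dist (f x) (f y) < \<eta>"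
  obtains g e where "continuous_on (\<Union>K) g" "\<And>x. x \<in> \<Union>K \<Longrightarrow> g x \<in> \<Union>K"
    "\<And>x. x \<in> \<Union>K \<Longrightarrow> dist (f x) (g x) < \<eta> + \<mu>" "e > 0"
    "finely_separated (submetric euclidean_metric (\<Union>K)) (2 * \<mu>)
       (eps_recurrent (submetric euclidean_metric (\<Union>K)) g e)"
proof -
  let ?m = "submetric euclidean_metric (\<Union>K)"
  define \<delta> where "\<delta> = 1 / (2 * real (card verts))"
  have "verts \<noteq> {}" using barycentric_large ne by blast
  then have "0 < card verts" using finite_verts by (simp add: card_gt_0_iff)
  then have \<delta>: "0 < \<delta>" "\<delta> < 1 / card verts" by (auto simp: \<delta>_def field_simps)
  obtain r where r: "continuous_on (\<Union>K) r" "\<And>C x. C \<in> K \<Longrightarrow> x \<in> C \<Longrightarrow> r x \<in> C"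
    "\<And>x. x \<in> \<Union>K \<Longrightarrow> \<exists>F\<in>K. r x \<in> F \<and> aff_dim F + 1 \<le> int (card {v \<in> verts. \<delta> < barycentric K x v})"
    by (rule shrink_to_large_corners[OF \<delta>]) (rule that)
  obtain h where h: "continuous_on (\<Union>K) h"
    "\<And>x. x \<in> \<Union>K \<Longrightarrow> \<exists>C\<in>K. f x \<in> C \<and> h x \<in> C"
    "\<And>F x. F \<in> K \<Longrightarrow> x \<in> F \<Longrightarrow> int (card {v \<in> verts. barycentric K (h x) v \<noteq> 0}) \<le> aff_dim F + 1"
    by (rule cellular_approximation[OF f]) (assumption | rule that)+
  define g where "g = h \<circ> r"
  have rK: "r x \<in> \<Union>K" if "x \<in> \<Union>K" for x using r(2) that by blast
  have gK: "g x \<in> \<Union>K" if "x \<in> \<Union>K" for x using h(2)[OF rK[OF that]] by (auto simp: g_def)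
  have g_cont: "continuous_on (\<Union>K) g"
    unfolding g_def using r(1) h(1) rK by (intro continuous_on_compose continuous_on_subset[OF h(1)]) auto
  define N where "N x = card {v \<in> verts. \<delta> \<le> barycentric K x v}" for x
  define M where "M x = card {v \<in> verts. \<delta> < barycentric K x v}" for x
  have MN: "M x \<le> N x" for x
    unfolding M_def N_def using finite_verts by (intro card_mono) auto
  have supp: "card {v \<in> verts. barycentric K (g x) v \<noteq> 0} \<le> M x" if x: "x \<in> \<Union>K" for x
  proof -
    obtain F where "F \<in> K" "r x \<in> F" "aff_dim F + 1 \<le> int (M x)"
      using r(3)[OF x] unfolding M_def by blast
    then show ?thesis using h(3)[of F "r x"] by (simp add: g_def)
  qed
  obtain e where e: "e > 0" "\<forall>x\<in>\<Union>K. \<forall>y\<in>\<Union>K. \<forall>v\<in>verts.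
      dist x y < e \<longrightarrow> \<bar>barycentric K x v - barycentric K y v\<bar> < \<delta>"
    using uniformly_continuous_barycentric[OF \<delta>(1)] by blast
  have step: "N y \<le> M x" if "x \<in> \<Union>K" "y \<in> \<Union>K" "dist (g x) y < e" for x y
  proof -
    have "{v \<in> verts. \<delta> \<le> barycentric K y v} \<subseteq> {v \<in> verts. barycentric K (g x) v \<noteq> 0}"
      using e(2) gK[OF that(1)] that(2,3) by force
    then have "N y \<le> card {v \<in> verts. barycentric K (g x) v \<noteq> 0}"
      unfolding N_def using finite_verts by (intro card_mono) auto
    then show ?thesis using supp[OF that(1)] by simp
  qed
  have "eps_recurrent ?m g e \<subseteq> {x \<in> \<Union>K. \<forall>v\<in>verts. barycentric K x v \<noteq> \<delta>}"
  proof
    fix x assume "x \<in> eps_recurrent ?m g e"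
    then have x: "x \<in> \<Union>K" and ch: "eps_chain ?m g e x x" by (auto simp: eps_recurrent_def)
    have "N x \<le> M x"
      by (rule eps_chain_potential_descent[OF ch]) (use step MN in auto)
    moreover have "{v \<in> verts. \<delta> < barycentric K x v} \<subseteq> {v \<in> verts. \<delta> \<le> barycentric K x v}" by auto
    ultimately have eq: "{v \<in> verts. \<delta> < barycentric K x v} = {v \<in> verts. \<delta> \<le> barycentric K x v}"
      unfolding N_def M_def using finite_verts by (intro card_seteq) auto
    have "barycentric K x v \<noteq> \<delta>" if "v \<in> verts" for v
      using that eqset_imp_iff[OF eq, of v] by auto
    with x show "x \<in> {x \<in> \<Union>K. \<forall>v\<in>verts. barycentric K x v \<noteq> \<delta>}" by blast
  qed
  then have "finely_separated ?m (2 * \<mu>) (eps_recurrent ?m g e)"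
    using finely_separated_off_threshold[OF mesh less_imp_le[OF \<delta>(1)] \<delta>(2)]
    by (rule finely_separated_subset[rotated])
  moreover have "dist (f x) (g x) < \<eta> + \<mu>" if x: "x \<in> \<Union>K" for x
  proof -
    obtain C where "C \<in> K" "x \<in> C" using x by blast
    then have "dist x (r x) < \<mu>" using r(2) by (intro dist_in_fine_simplex[OF mesh])
    then have "dist (f x) (f (r x)) < \<eta>" using close x rK by blast
    moreover obtain D where "D \<in> K" "f (r x) \<in> D" "h (r x) \<in> D" using h(2)[OF rK[OF x]] by blast
    then have "dist (f (r x)) (g x) < \<mu>"
      unfolding g_def comp_def by (intro dist_in_fine_simplex[OF mesh])
    ultimately show ?thesis using dist_triangle[of "f x" "g x" "f (r x)"] by linarith
  qed
  ultimately show ?thesis by (intro that[of g e] g_cont gK e(1))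
qed

end

theorem theorem3p3:
  fixes W :: "'a::euclidean_space set set"
  assumes "simplicial_complex W" and "\<Union>W \<noteq> {}"
  shows "submetric euclidean_metric (\<Union>W) \<in> zero_CR"
proof (rule zero_CR_if_dense_finely_separated)
  interpret W: geometric_complex W using assms(1) by unfold_locales
  let ?X = "\<Union>W"
  let ?m = "submetric euclidean_metric ?X"
  have top: "mtopology_of ?m = top_of_set ?X" by (simp add: mtopology_of_submetric)
  have cpt: "compact ?X" by (rule W.compact_polyhedron)
  then have cptop: "compact_space (top_of_set ?X)" by (simp add: compact_space_subtopology)
  show "compact_space (mtopology_of ?m)" using cptop top by simp
  show "mspace ?m \<noteq> {}" using assms(2) by simp
  fix f \<epsilon> assume f: "f \<in> mspace (self_maps ?m)" and \<epsilon>: "(\<epsilon>::real) > 0"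
  have f_cont: "continuous_on ?X f" and fX: "\<And>x. x \<in> ?X \<Longrightarrow> f x \<in> ?X"
    using f by (auto simp: self_maps_def top)
  obtain \<mu>' where \<mu>': "\<mu>' > 0" "\<And>x y. x \<in> ?X \<Longrightarrow> y \<in> ?X \<Longrightarrow> dist x y < \<mu>' \<Longrightarrow> dist (f x) (f y) < \<epsilon>/2"
    using compact_uniformly_continuous[OF f_cont cpt] half_gt_zero[OF \<epsilon>]
    unfolding uniformly_continuous_on_def by meson
  define \<mu> where "\<mu> = min \<mu>' (\<epsilon>/2)"
  have \<mu>: "\<mu> > 0" "\<mu> \<le> \<mu>'" "\<mu> \<le> \<epsilon>/2" using \<mu>'(1) \<epsilon> by (auto simp: \<mu>_def)
  obtain K where K: "geometric_complex K" "\<Union>K = ?X" "\<And>C. C \<in> K \<Longrightarrow> diameter C < \<mu>"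
    by (rule W.fine_subdivision[OF \<mu>(1)]) (rule that)
  interpret K: geometric_complex K by fact
  obtain g d where g: "continuous_on ?X g" "\<And>x. x \<in> ?X \<Longrightarrow> g x \<in> ?X"
    "\<And>x. x \<in> ?X \<Longrightarrow> dist (f x) (g x) < \<epsilon>/2 + \<mu>" and d: "d > 0"
    "finely_separated ?m (2 * \<mu>) (eps_recurrent ?m g d)"
  proof (rule K.separating_approximation[of f \<mu> "\<epsilon>/2", unfolded K(2)])
    show "dist (f x) (f y) < \<epsilon>/2" if "x \<in> ?X" "y \<in> ?X" "dist x y < \<mu>" for x y
      using \<mu>'(2) \<mu>(2) that by (meson order_less_le_trans)
  qed (use f_cont fX K(3) assms(2) that in \<open>auto simp: K(2)\<close>)
  \<comment> \<open>Elements of the function space take a fixed default value outside the polyhedron, which g need not do.\<close>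
  define g' where "g' = restrict g ?X"
  have "eps_recurrent ?m g' d \<subseteq> eps_recurrent ?m g d"
    using eps_chain_perturb[of ?m g' d _ _ g 0] g(2)
    by (auto simp: eps_recurrent_def g'_def)
  then have "finely_separated ?m \<epsilon> (eps_recurrent ?m g' d)"
    using finely_separated_mono[OF finely_separated_subset[OF d(2)]] \<mu>(3) by simp
  moreover have "g' \<in> mspace (self_maps ?m)"
  proof -
    have "continuous_on ?X g'" by (rule continuous_on_eq[OF g(1)]) (simp add: g'_def)
    then show ?thesis
      using g(2) cptop unfolding self_maps_def
      by (subst compactin_mspace_cfunspace) (auto simp: top g'_def compact_space_def)
  qed
  moreover have "\<forall>x\<in>mspace ?m. mdist ?m (f x) (g' x) < \<epsilon>"
    using g(3) \<mu>(3) by (fastforce simp: g'_def)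
  ultimately show "\<exists>g\<in>mspace (self_maps ?m). (\<forall>x\<in>mspace ?m. mdist ?m (f x) (g x) < \<epsilon>) \<and>
          (\<exists>d>0. finely_separated ?m \<epsilon> (eps_recurrent ?m g d))"
    using d(1) by blast
qed

end
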